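(* Let $n\ge 1$ and let $K_1,\dots,K_n$ be collectively nowhere flat locally connected subspaces of $\mathbb{R}^n$. For any sets $B_1\subset K_1,\dots,B_n\subset K_n$ such that each $B_i$ is non-meager in $K_i$, the algebraic sum $B_1+\dots+B_n$ is non-meager in $\mathbb{R}^n$.
   Context: Subsets $A_1,\dots,A_n$ of $\mathbb{R}^n$ are called collectively nowhere flat in $\mathbb{R}^n$ if any non-empty relatively open subsets $U_1\subset A_1,\dots,U_n\subset A_n$ contain points $a_1,b_1\in U_1,\dots,a_n,b_n\in U_n$ such that the vectors $b_1-a_1,\dots,b_n-a_n$ form a basis of the linear space $\mathbb{R}^n$. The algebraic sum is $B_1+\dots+B_n=\{b_1+\dots+b_n: b_i\in B_i\}$. A subset is non-meager in a topological space if it is not of first category in it (not a countable union of nowhere dense subsets of that space); each $K_i$ carries the subspace topology. *)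

theory Defs
  imports "HOL-Analysis.Analysis"
begin

definition nowhere_dense_in :: "'a topology \<Rightarrow> 'a set \<Rightarrow> bool"
  where "nowhere_dense_in X N \<longleftrightarrow>
    N \<subseteq> topspace X \<and> X interior_of (X closure_of N) = {}"

definition meager_in :: "'a topology \<Rightarrow> 'a set \<Rightarrow> bool"
  where "meager_in X S \<longleftrightarrow>
    (\<exists>\<N>. countable \<N> \<and> (\<forall>N\<in>\<N>. nowhere_dense_in X N) \<and> S = \<Union>\<N>)"

(* A basis as an indexed family: injectivity excludes repeated vectors, which the range forgets. *)
definition basis_family :: "('i \<Rightarrow> 'a::real_vector) \<Rightarrow> bool"
  where "basis_family v \<longleftrightarrow>
    inj v \<and> independent (range v) \<and> span (range v) = UNIV"

(* The index type of the family is that of the coordinates, so there are exactly as many sets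
   as the dimension of the space. *)
definition collectively_nowhere_flat :: "('n \<Rightarrow> (real ^ 'n) set) \<Rightarrow> bool"
  where "collectively_nowhere_flat A \<longleftrightarrow>
    (\<forall>U. (\<forall>i. openin (top_of_set (A i)) (U i) \<and> U i \<noteq> {}) \<longrightarrow>
      (\<exists>a b. (\<forall>i. a i \<in> U i \<and> b i \<in> U i) \<and> basis_family (\<lambda>i. b i - a i)))"

end

theory Submission
  imports Defs
begin

text \<open>
  If \<open>B\<^sub>1 + \<dots> + B\<^sub>n\<close> were covered by countably many closed sets with empty interior, a
  Kuratowski--Ulam type induction on \<open>n\<close> would put a sum \<open>U\<^sub>1 + \<dots> + U\<^sub>n\<close> of non-empty
  relatively open sets \<open>U\<^sub>i \<subseteq> K\<^sub>i\<close> inside one of them. By local connectedness the \<open>U\<^sub>i\<close> may be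
  taken connected and bounded, and by non-flatness they contain \<open>a\<^sub>i\<close>, \<open>b\<^sub>i\<close> such that the
  vectors \<open>v\<^sub>i = b\<^sub>i - a\<^sub>i\<close> form a basis. The closure of the sum then has non-empty interior, because
  its translates by the lattice generated by the \<open>v\<^sub>i\<close> cover the space: extending paths from
  \<open>a\<^sub>i\<close> to \<open>b\<^sub>i\<close> to the line by \<open>\<gamma>\<^sub>i (t + 1) = \<gamma>\<^sub>i t + v\<^sub>i\<close>, the map
  \<open>t \<mapsto> \<Sum>\<^sub>i \<gamma>\<^sub>i t\<^sub>i\<close> is a bounded perturbation of a linear surjection, hence surjective by
  Brouwer's fixed point theorem.
\<close>

section \<open>Baire category and sums of non-meager sets\<close>

lemma meager_in_subset_countable_Union_closedin:
  assumes "countable \<C>" "\<And>C. C \<in> \<C> \<Longrightarrow> closedin X C \<and> X interior_of C = {}"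
    and "S \<subseteq> \<Union>\<C>"
  shows "meager_in X S"
  unfolding meager_in_def nowhere_dense_in_def
proof (intro exI conjI ballI)
  show "countable ((\<inter>) S ` \<C>)"
    using assms(1) by blast
  show "S = \<Union> ((\<inter>) S ` \<C>)"
    using assms(3) by blast
next
  fix N assume "N \<in> (\<inter>) S ` \<C>"
  then obtain C where C: "C \<in> \<C>" "N \<subseteq> C"
    by blast
  then have "X closure_of N \<subseteq> C" "C \<subseteq> topspace X"
    using assms(2) by (simp_all add: closure_of_minimal closedin_subset)
  then show "N \<subseteq> topspace X" "X interior_of (X closure_of N) = {}"
    using C assms(2)[of C] interior_of_mono[of "X closure_of N" C X] by auto
qed

lemma nonmeager_in_closedin_cover:
  assumes "\<not> meager_in X S" "countable \<C>" "\<And>C. C \<in> \<C> \<Longrightarrow> closedin X C" "S \<subseteq> \<Union>\<C>"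
  obtains C where "C \<in> \<C>" "X interior_of C \<noteq> {}"
  using assms meager_in_subset_countable_Union_closedin[of \<C> X S] by blast

text \<open>Induction on the index set, Kuratowski-Ulam style. Each fixed \<open>x \<in> B j\<close>
  yields, by the induction hypothesis, a set \<open>F\<close> and a relatively open box in the
  remaining factors. Boxes taken from a countable base leave only countably many pairs
  \<open>(F, U)\<close>, so non-meagerness of \<open>B j\<close> makes a single pair work on a whole
  relatively open piece of \<open>K j\<close>.\<close>

lemma sum_nonmeager_closed_cover:
  fixes K B :: "'i \<Rightarrow> 'a::{second_countable_topology, topological_ab_group_add} set"
  assumes "finite I"
    and "\<And>i. i \<in> I \<Longrightarrow> \<not> meager_in (top_of_set (K i)) (B i)"
    and "\<And>i. i \<in> I \<Longrightarrow> B i \<subseteq> K i"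
    and "countable \<F>" and "\<And>F. F \<in> \<F> \<Longrightarrow> closed F"
    and "\<And>b. (\<And>i. i \<in> I \<Longrightarrow> b i \<in> B i) \<Longrightarrow> sum b I \<in> \<Union>\<F>"
  shows "\<exists>F\<in>\<F>. \<exists>U. (\<forall>i\<in>I. open (U i) \<and> K i \<inter> U i \<noteq> {}) \<and>
           (\<forall>u. (\<forall>i\<in>I. u i \<in> K i \<inter> U i) \<longrightarrow> sum u I \<in> F)"
  using assms
proof (induction I arbitrary: \<F> rule: finite_induct)
  case empty
  then show ?case by auto
next
  case (insert j I)
  obtain \<B> :: "'a set set" where \<B>: "countable \<B>" "topological_basis \<B>"
    using ex_countable_basis by blast
  \<comment> \<open>The extensional function space over the finite set \<open>I\<close> keeps
    \<open>P\<close> countable. \<open>C (F, U)\<close> collects the \<open>x\<close> that serve for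
    one pair; it is closed in \<open>K j\<close>, being cut out by preimages of \<open>F\<close>
    under translations.\<close>
  define P where "P = (SIGMA F : \<F>. {U \<in> I \<rightarrow>\<^sub>E \<B>. \<forall>i\<in>I. K i \<inter> U i \<noteq> {}})"
  define C where "C = (\<lambda>(F, U). {x \<in> K j. \<forall>u. (\<forall>i\<in>I. u i \<in> K i \<inter> U i) \<longrightarrow> x + sum u I \<in> F})"
  have "countable (I \<rightarrow>\<^sub>E \<B>)"
    using insert.hyps(1) \<B>(1) by (intro countable_PiE)
  then have "countable {U \<in> I \<rightarrow>\<^sub>E \<B>. \<forall>i\<in>I. K i \<inter> U i \<noteq> {}}"
    by (rule countable_subset[rotated]) blast
  then have "countable P"
    unfolding P_def using insert.prems(3) by (intro countable_SIGMA)
  have closedin_C: "closedin (top_of_set (K j)) (C p)" if "p \<in> P" for p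
  proof -
    obtain F U where p: "p = (F, U)" by fastforce
    have "closed F"
      using that p insert.prems(4) by (auto simp: P_def)
    have "C p = K j \<inter> (\<Inter>u\<in>{u. \<forall>i\<in>I. u i \<in> K i \<inter> U i}. (\<lambda>x. x + sum u I) -` F)"
      unfolding C_def p by auto
    moreover have "closed (\<Inter>u\<in>{u. \<forall>i\<in>I. u i \<in> K i \<inter> U i}. (\<lambda>x. x + sum u I) -` F)"
      by (intro closed_INT ballI closed_vimage \<open>closed F\<close> continuous_intros)
    ultimately show ?thesis
      by (simp add: closedin_closed_Int)
  qed
  have cover: "B j \<subseteq> \<Union>(C ` P)"
  proof
    fix x assume x: "x \<in> B j"
    \<comment> \<open>The induction hypothesis is applied to the cover shifted by
      \<open>- x\<close>, which is why the cover is generalised in the induction.\<close>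
    have "\<exists>F\<in>(\<lambda>F. (\<lambda>y. x + y) -` F) ` \<F>. \<exists>U. (\<forall>i\<in>I. open (U i) \<and> K i \<inter> U i \<noteq> {}) \<and>
           (\<forall>u. (\<forall>i\<in>I. u i \<in> K i \<inter> U i) \<longrightarrow> sum u I \<in> F)"
    proof (rule insert.IH)
      show "\<not> meager_in (top_of_set (K i)) (B i)" if "i \<in> I" for i
        using that insert.prems(1) by blast
      show "B i \<subseteq> K i" if "i \<in> I" for i
        using that insert.prems(2) by blast
      show "countable ((\<lambda>F. (\<lambda>y. x + y) -` F) ` \<F>)"
        using insert.prems(3) by blast
      show "closed F" if "F \<in> (\<lambda>F. (\<lambda>y. x + y) -` F) ` \<F>" for F
        using that insert.prems(4) by (auto intro!: closed_vimage continuous_intros)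
      fix b assume b: "\<And>i. i \<in> I \<Longrightarrow> b i \<in> B i"
      have "sum (b(j := x)) (insert j I) \<in> \<Union>\<F>"
        using b x by (intro insert.prems(5)) auto
      moreover have "sum (b(j := x)) I = sum b I"
        using insert.hyps by (intro sum.cong) auto
      ultimately show "sum b I \<in> \<Union> ((\<lambda>F. (\<lambda>y. x + y) -` F) ` \<F>)"
        using insert.hyps by auto
    qed
    then obtain F U where F: "F \<in> \<F>"
      and U: "\<And>i. i \<in> I \<Longrightarrow> open (U i)" "\<And>i. i \<in> I \<Longrightarrow> K i \<inter> U i \<noteq> {}"
      and sub: "\<forall>u. (\<forall>i\<in>I. u i \<in> K i \<inter> U i) \<longrightarrow> x + sum u I \<in> F"
      by auto
    have "\<exists>V. V \<in> \<B> \<and> V \<subseteq> U i \<and> K i \<inter> V \<noteq> {}" if i: "i \<in> I" for i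
    proof -
      obtain y where "y \<in> K i" "y \<in> U i" using U(2)[OF i] by blast
      with topological_basisE[OF \<B>(2) U(1)[OF i]] show ?thesis by blast
    qed
    then obtain V where V: "\<And>i. i \<in> I \<Longrightarrow> V i \<in> \<B> \<and> V i \<subseteq> U i \<and> K i \<inter> V i \<noteq> {}"
      by metis
    \<comment> \<open>Restriction makes \<open>V\<close> extensional, as membership in
      \<open>P\<close> demands.\<close>
    have "(F, restrict V I) \<in> P"
      using F V by (auto simp: P_def)
    moreover have "x + sum u I \<in> F" if "\<forall>i\<in>I. u i \<in> K i \<inter> restrict V I i" for u
      using that V by (intro sub[rule_format]) fastforce
    then have "x \<in> C (F, restrict V I)"
      using x insert.prems(2) unfolding C_def by blast
    ultimately show "x \<in> \<Union>(C ` P)" by blast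
  qed
  obtain F U where FU: "(F, U) \<in> P" and int: "top_of_set (K j) interior_of C (F, U) \<noteq> {}"
    by (rule nonmeager_in_closedin_cover[OF insert.prems(1)[of j], of "C ` P"])
      (use \<open>countable P\<close> closedin_C cover in auto)
  obtain T where "open T" "top_of_set (K j) interior_of C (F, U) = K j \<inter> T"
    using openin_interior_of[of "top_of_set (K j)" "C (F, U)"] unfolding openin_open by blast
  then have T: "open T" "K j \<inter> T \<noteq> {}" "K j \<inter> T \<subseteq> C (F, U)"
    using int interior_of_subset[of "top_of_set (K j)" "C (F, U)"] by auto
  have "sum u (insert j I) \<in> F"
    if "\<forall>i\<in>insert j I. u i \<in> K i \<inter> (U(j := T)) i" for u
  proof -
    have "\<forall>i\<in>I. u i \<in> K i \<inter> U i"
      using that insert.hyps(2) by (metis fun_upd_apply insertCI)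
    moreover have "u j \<in> C (F, U)"
      using that T(3) by auto
    ultimately show ?thesis
      using insert.hyps by (auto simp: C_def)
  qed
  moreover have "\<forall>i\<in>insert j I. open ((U(j := T)) i) \<and> K i \<inter> (U(j := T)) i \<noteq> {}"
    using T(1,2) FU topological_basis_open[OF \<B>(2)] by (auto simp: P_def)
  moreover have "F \<in> \<F>"
    using FU by (simp add: P_def)
  ultimately show ?case by blast
qed

section \<open>Periodic extension of paths and covering by lattice translates\<close>

lemma continuous_on_compose_frac:
  fixes h :: "real \<Rightarrow> 'a::topological_space"
  assumes h: "continuous_on {0..1} h" and "h 0 = h 1"
  shows "continuous_on UNIV (\<lambda>x. h (frac x))"
  unfolding continuous_on_eq_continuous_at[OF open_UNIV]
proof
  fix x :: real
  define m :: real where "m = of_int \<lfloor>x\<rfloor>"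
  \<comment> \<open>On each of the two closed unit intervals meeting at \<open>m\<close> the
    function is a shift of \<open>h\<close>. At a right endpoint \<open>frac\<close> drops to 0
    while the shift reaches 1; there \<open>h 0 = h 1\<close> is what makes them agree.\<close>
  have "continuous_on ({m - 1..m} \<union> {m..m + 1}) (\<lambda>x. h (frac x))"
  proof (intro continuous_on_closed_Un closed_atLeastAtMost)
    have "continuous_on {m - 1..m} (\<lambda>x. h (x - (m - 1)))"
      by (intro continuous_on_compose2[OF h] continuous_intros) auto
    moreover have "h (y - (m - 1)) = h (frac y)" if "y \<in> {m - 1..m}" for y
    proof (cases "y = m")
      case True
      then show ?thesis using \<open>h 0 = h 1\<close> by (simp add: m_def)
    next
      case False
      with that have "\<lfloor>y\<rfloor> = \<lfloor>x\<rfloor> - 1" by (simp add: m_def floor_eq_iff)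
      then show ?thesis by (simp add: frac_def m_def)
    qed
    ultimately show "continuous_on {m - 1..m} (\<lambda>x. h (frac x))"
      by (rule continuous_on_eq)
    have "continuous_on {m..m + 1} (\<lambda>x. h (x - m))"
      by (intro continuous_on_compose2[OF h] continuous_intros) auto
    moreover have "h (y - m) = h (frac y)" if "y \<in> {m..m + 1}" for y
    proof (cases "y = m + 1")
      case True
      then have "y = of_int (\<lfloor>x\<rfloor> + 1)" by (simp add: m_def)
      then have "frac y = 0" by (metis frac_of_int)
      moreover have "y - m = 1" using True by simp
      ultimately show ?thesis using \<open>h 0 = h 1\<close> by metis
    next
      case False
      with that have "\<lfloor>y\<rfloor> = \<lfloor>x\<rfloor>" by (simp add: m_def floor_eq_iff)
      then show ?thesis by (simp add: frac_def m_def)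
    qed
    ultimately show "continuous_on {m..m + 1} (\<lambda>x. h (frac x))"
      by (rule continuous_on_eq)
  qed
  then have "continuous_on {m - 1<..<m + 1} (\<lambda>x. h (frac x))"
    by (rule continuous_on_subset) auto
  moreover have "x \<in> {m - 1<..<m + 1}"
    unfolding m_def by (simp; linarith)
  ultimately show "isCont (\<lambda>x. h (frac x)) x"
    by (meson continuous_on_eq_continuous_at open_greaterThanLessThan)
qed

lemma linear_sum_scaleR: "linear (\<lambda>t::real^'n. \<Sum>i\<in>UNIV. t $ i *\<^sub>R v i)"
  by (intro linearI) (simp_all add: scaleR_left_distrib sum.distrib scaleR_sum_right)

lemma surj_sum_scaleR:
  fixes v :: "'n::finite \<Rightarrow> 'a::real_vector"
  assumes "span (range v) = UNIV"
  shows "surj (\<lambda>t::real^'n. \<Sum>i\<in>UNIV. t $ i *\<^sub>R v i)" (is "surj ?L")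
proof -
  have "v i = ?L (axis i 1)" for i
    by (simp add: axis_def if_distrib[of "\<lambda>c. c *\<^sub>R _"] cong: if_cong)
  then have "range v \<subseteq> range ?L"
    by blast
  then have "span (range v) \<subseteq> range ?L"
    by (intro span_minimal linear_subspace_image linear_sum_scaleR) auto
  then show ?thesis
    using assms by auto
qed

text \<open>The extended path number \<open>i\<close> splits into the linear part
  \<open>t *\<^sub>R v i\<close> and a continuous part of period 1. The sum of the paths is thus
  \<open>L + G\<close> with \<open>G\<close> bounded, and solving \<open>L t + G t = x\<close>
  becomes a fixed point problem.\<close>

lemma sum_paths_plus_lattice:
  fixes g :: "'n::finite \<Rightarrow> real \<Rightarrow> real^'n" and v :: "'n \<Rightarrow> real^'n"
  assumes "\<And>i. path (g i)" and v: "\<And>i. v i = pathfinish (g i) - pathstart (g i)"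
    and span: "span (range v) = UNIV"
  obtains s :: "'n \<Rightarrow> real" and k :: "'n \<Rightarrow> int"
  where "\<And>i. s i \<in> {0..1}" "x = (\<Sum>i\<in>UNIV. g i (s i)) + (\<Sum>i\<in>UNIV. of_int (k i) *\<^sub>R v i)"
proof -
  define L where "L = (\<lambda>t::real^'n. \<Sum>i\<in>UNIV. t $ i *\<^sub>R v i)"
  have "linear L" "surj L"
    unfolding L_def by (fact linear_sum_scaleR surj_sum_scaleR[OF span])+
  then obtain M where "linear M" and LM: "\<And>y. L (M y) = y"
    using linear_surjective_right_inverse[of L] by (auto simp: fun_eq_iff)
  \<comment> \<open>Subtracting the drift makes the values at 0 and 1 equal, so the periodic
    extension is continuous.\<close>
  define h where "h = (\<lambda>i s. g i s - s *\<^sub>R v i)"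
  have h: "continuous_on {0..1} (h i)" for i
    using assms(1)[of i] unfolding h_def path_def by (intro continuous_intros)
  define G where "G = (\<lambda>t::real^'n. \<Sum>i\<in>UNIV. h i (frac (t $ i)))"
  have "h i 0 = h i 1" for i
    using v[of i] by (simp add: h_def pathfinish_def pathstart_def)
  then have "continuous_on UNIV (\<lambda>s. h i (frac s))" for i
    by (intro continuous_on_compose_frac h)
  then have "continuous_on UNIV (\<lambda>t::real^'n. h i (frac (t $ i)))" for i
    by (rule continuous_on_compose2) (auto intro: continuous_intros)
  then have contG: "continuous_on UNIV G"
    unfolding G_def by (intro continuous_on_sum)
  have "\<exists>c. \<forall>s\<in>{0..1}. norm (h i s) \<le> c" for i
    using compact_imp_bounded[OF compact_continuous_image[OF h[of i] compact_Icc]]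
    by (auto simp: bounded_iff)
  then obtain c where c: "\<And>i s. s \<in> {0..1} \<Longrightarrow> norm (h i s) \<le> c i"
    by metis
  have "norm (G t) \<le> (\<Sum>i\<in>UNIV. c i)" for t
    unfolding G_def
    by (intro order_trans[OF norm_sum] sum_mono c) (simp add: less_imp_le[OF frac_lt_1])
  then have "bounded (range (\<lambda>t. x - G t))"
    by (intro bounded_minus_comp) (auto simp: bounded_iff)
  then have "bounded (M ` range (\<lambda>t. x - G t))"
    using \<open>linear M\<close> by (simp add: bounded_linear_image linear_conv_bounded_linear)
  then obtain R where "R > 0" and R: "\<And>t. norm (M (x - G t)) \<le> R"
    by (auto simp: bounded_pos image_iff)
  \<comment> \<open>Boundedness of \<open>G\<close> sends the ball of radius \<open>R\<close> into
    itself; since \<open>L\<close> inverts \<open>M\<close> on the left, a fixed point solves the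
    equation.\<close>
  obtain t where "M (x - G t) = t"
  proof (rule brouwer[of "cball 0 R" "\<lambda>t. M (x - G t)"])
    show "continuous_on (cball 0 R) (\<lambda>t. M (x - G t))"
      using continuous_on_compose2[OF linear_continuous_on[of M UNIV], of "cball 0 R" "\<lambda>t. x - G t"]
        continuous_on_diff[OF continuous_on_const continuous_on_subset[OF contG]] \<open>linear M\<close>
      by (simp add: linear_conv_bounded_linear)
  qed (use \<open>R > 0\<close> R in auto)
  then have "x = L t + G t"
    using LM[of "x - G t"] by simp
  also have "\<dots> = (\<Sum>i\<in>UNIV. t $ i *\<^sub>R v i + h i (frac (t $ i)))"
    by (simp add: L_def G_def sum.distrib)
  \<comment> \<open>The fractional part of each coordinate is the path parameter, the integer part
    the lattice coefficient.\<close>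
  also have "\<dots> = (\<Sum>i\<in>UNIV. g i (frac (t $ i)) + of_int \<lfloor>t $ i\<rfloor> *\<^sub>R v i)"
    by (intro sum.cong) (simp_all add: h_def frac_def algebra_simps)
  finally show ?thesis
    by (intro that[of "\<lambda>i. frac (t $ i)" "\<lambda>i. \<lfloor>t $ i\<rfloor>"])
      (simp_all add: sum.distrib less_imp_le[OF frac_lt_1])
qed

text \<open>A connected set may contain no path from \<open>a\<close> to \<open>b\<close>, but its
  open \<open>\<epsilon>\<close>-neighbourhood is connected and open, hence path connected.\<close>

lemma connected_imp_path_within:
  fixes S :: "'a::real_normed_vector set"
  assumes "connected S" "a \<in> S" "b \<in> S" "\<epsilon> > 0"
  obtains g where "path g" "pathstart g = a" "pathfinish g = b"
    "\<And>s. s \<in> {0..1} \<Longrightarrow> \<exists>c\<in>S. dist c (g s) < \<epsilon>"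
proof -
  define N where "N = (\<Union>c\<in>S. ball c \<epsilon>)"
  \<comment> \<open>In this form the members are connected and all contain \<open>S\<close>.\<close>
  have N: "N = (\<Union>c\<in>S. S \<union> ball c \<epsilon>)"
    using assms(2,4) unfolding N_def by force
  have "connected N"
    unfolding N using assms
    by (intro connected_Union) (auto intro!: connected_Un connected_ball)
  then have "path_connected N"
    by (intro connected_open_path_connected) (auto simp: N_def)
  moreover have "S \<subseteq> N"
    unfolding N_def using \<open>\<epsilon> > 0\<close> centre_in_ball by blast
  ultimately obtain g where "path g" "path_image g \<subseteq> N" "pathstart g = a" "pathfinish g = b"
    using assms(2,3) unfolding path_connected_def by blast
  moreover have "\<exists>c\<in>S. dist c (g s) < \<epsilon>" if "s \<in> {0..1}" for s
  proof -
    have "g s \<in> N"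
      using that \<open>path_image g \<subseteq> N\<close> unfolding path_image_def by blast
    then show ?thesis
      by (simp add: N_def)
  qed
  ultimately show ?thesis
    by (intro that[of g])
qed

text \<open>Paths that only stay near the \<open>S i\<close> show that the lattice translates of the
  sum are dense. The closure of the bounded sum is compact and the lattice is closed, so their sum
  is closed and therefore everything; Baire's theorem then excludes empty interior.\<close>

lemma interior_closure_sum_connected_nonempty:
  fixes S :: "'n::finite \<Rightarrow> (real^'n) set"
  assumes conn: "\<And>i. connected (S i)" and bdd: "\<And>i. bounded (S i)"
    and a: "\<And>i. a i \<in> S i" and b: "\<And>i. b i \<in> S i"
    and span: "span (range (\<lambda>i. b i - a i)) = UNIV"
  shows "interior (closure {\<Sum>i\<in>UNIV. u i | u. \<forall>i. u i \<in> S i}) \<noteq> {}"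
proof
  define A where "A = {\<Sum>i\<in>UNIV. u i | u. \<forall>i. u i \<in> S i}"
  define v where "v = (\<lambda>i. b i - a i)"
  define L where "L = (\<lambda>t::real^'n. \<Sum>i\<in>UNIV. t $ i *\<^sub>R v i)"
  define Z where "Z = L ` {t. \<forall>i. t $ i \<in> \<int>}"
  assume "interior (closure {\<Sum>i\<in>UNIV. u i | u. \<forall>i. u i \<in> S i}) = {}"
  then have int_A: "interior (closure A) = {}"
    by (simp add: A_def)
  have "linear L" "surj L"
    unfolding L_def v_def by (fact linear_sum_scaleR surj_sum_scaleR[OF span])+
  then have "inj L"
    by (intro linear_surjective_imp_injective refl)
  have "closed ((\<lambda>t::real^'n. t $ i) -` \<int>)" for i
    by (intro closed_vimage closed_Ints continuous_intros)
  then have "closed {t::real^'n. \<forall>i. t $ i \<in> \<int>}"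
    by (intro closed_Collect_all) (simp add: vimage_def)
  then have "closed Z"
    unfolding Z_def using \<open>linear L\<close> \<open>inj L\<close> by (intro closed_injective_linear_image)
  have "{t::real^'n. \<forall>i. t $ i \<in> \<int>} \<subseteq> range (\<lambda>k. \<chi> i. of_int (k i))"
  proof
    fix t :: "real^'n" assume "t \<in> {t. \<forall>i. t $ i \<in> \<int>}"
    then have "t = (\<chi> i. of_int \<lfloor>t $ i\<rfloor>)"
      by (simp add: vec_eq_iff)
    then show "t \<in> range (\<lambda>k. \<chi> i. of_int (k i))"
      by (intro range_eqI[where x = "\<lambda>i. \<lfloor>t $ i\<rfloor>"])
  qed
  moreover have "countable (UNIV :: ('n \<Rightarrow> int) set)"
    using countable_PiE[of "UNIV :: 'n set" "\<lambda>_. UNIV :: int set"] by simp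
  ultimately have "countable Z"
    unfolding Z_def by (meson countable_image countable_subset)
  obtain r where r: "\<And>i c. c \<in> S i \<Longrightarrow> norm c \<le> r i"
    using bdd unfolding bounded_iff by metis
  have "bounded A"
    unfolding A_def bounded_iff using r
    by (auto intro!: exI[of _ "sum r UNIV"] order_trans[OF norm_sum] sum_mono)
  then have "compact (closure A)"
    by simp
  then have closed: "closed (\<Union>y\<in>closure A. \<Union>z\<in>Z. {y + z})"
    using \<open>closed Z\<close> by (rule compact_closed_sums)
  have "x \<in> closure (\<Union>y\<in>closure A. \<Union>z\<in>Z. {y + z})" for x
    unfolding closure_approachable
  proof (intro allI impI)
    fix e :: real assume "e > 0"
    \<comment> \<open>One error below \<open>\<epsilon>\<close> per coordinate adds up to less than
      \<open>e\<close>.\<close>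
    define \<epsilon> where "\<epsilon> = e / real CARD('n)"
    have "\<epsilon> > 0"
      using \<open>e > 0\<close> by (simp add: \<epsilon>_def)
    have "\<exists>g. path g \<and> pathstart g = a i \<and> pathfinish g = b i \<and>
        (\<forall>s\<in>{0..1}. \<exists>c\<in>S i. dist c (g s) < \<epsilon>)" for i
      using connected_imp_path_within[OF conn a b \<open>\<epsilon> > 0\<close>] by metis
    then obtain g where g: "\<And>i. path (g i)" "\<And>i. pathstart (g i) = a i" "\<And>i. pathfinish (g i) = b i"
        "\<And>i s. s \<in> {0..1} \<Longrightarrow> \<exists>c\<in>S i. dist c (g i s) < \<epsilon>"
      by metis
    obtain s k where s: "\<And>i. s i \<in> {0..1}"
      and x: "x = (\<Sum>i\<in>UNIV. g i (s i)) + (\<Sum>i\<in>UNIV. of_int (k i) *\<^sub>R v i)"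
      by (rule sum_paths_plus_lattice[of g v x]) (use g span in \<open>auto simp: v_def\<close>)
    have "\<exists>c. c \<in> S i \<and> dist c (g i (s i)) < \<epsilon>" for i
      using g(4)[OF s] by blast
    then obtain c where c: "\<And>i. c i \<in> S i" "\<And>i. dist (c i) (g i (s i)) < \<epsilon>"
      by metis
    define z where "z = L (\<chi> i. of_int (k i))"
    have "dist (sum c UNIV + z) x = norm (\<Sum>i\<in>UNIV. c i - g i (s i))"
      by (simp add: x z_def L_def dist_norm sum_subtractf)
    also have "\<dots> \<le> (\<Sum>i\<in>UNIV. norm (c i - g i (s i)))"
      by (rule norm_sum)
    also have "\<dots> < (\<Sum>i\<in>(UNIV::'n set). \<epsilon>)"
      using c(2) by (intro sum_strict_mono) (auto simp: dist_norm)
    also have "\<dots> = e"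
      by (simp add: \<epsilon>_def)
    finally have "dist (sum c UNIV + z) x < e" .
    moreover have "sum c UNIV \<in> closure A"
      using c(1) closure_subset by (force simp: A_def)
    moreover have "z \<in> Z"
      by (auto simp: z_def Z_def)
    ultimately show "\<exists>y\<in>\<Union>y\<in>closure A. \<Union>z\<in>Z. {y + z}. dist y x < e"
      by blast
  qed
  then have "(\<Union>y\<in>closure A. \<Union>z\<in>Z. {y + z}) = UNIV"
    using closed by (simp add: set_eq_iff)
  moreover have "(\<Union>z\<in>Z. (+) z ` closure A) = (\<Union>y\<in>closure A. \<Union>z\<in>Z. {y + z})"
    by (force simp: add.commute)
  ultimately have "(\<Union>z\<in>Z. (+) z ` closure A) = UNIV"
    by simp
  \<comment> \<open>Countably many closed translates with empty interior cannot fill the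
    space.\<close>
  moreover have "euclidean interior_of (\<Union>z\<in>Z. (+) z ` closure A) = {}"
    using \<open>countable Z\<close> int_A
    by (intro Baire_category_alt)
      (auto simp: completely_metrizable_space_euclidean closed_translation interior_translation)
  ultimately show False
    by simp
qed

section \<open>From a countable closed cover to a contradiction\<close>

theorem theorem5:
  fixes K B :: "'n::finite \<Rightarrow> (real ^ 'n) set"
  assumes "collectively_nowhere_flat K"
    and "\<And>i. locally connected (K i)"
    and "\<And>i. B i \<subseteq> K i"
    and "\<And>i. \<not> meager_in (top_of_set (K i)) (B i)"
  shows "\<not> meager_in euclidean {\<Sum>i\<in>UNIV. b i | b. \<forall>i. b i \<in> B i}"
proof
  assume "meager_in euclidean {\<Sum>i\<in>UNIV. b i | b. \<forall>i. b i \<in> B i}"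
  then obtain \<N> where \<N>: "countable \<N>" "\<And>N. N \<in> \<N> \<Longrightarrow> interior (closure N) = {}"
    and sum: "{\<Sum>i\<in>UNIV. b i | b. \<forall>i. b i \<in> B i} = \<Union>\<N>"
    by (auto simp: meager_in_def nowhere_dense_in_def)
  have "sum b UNIV \<in> \<Union>(closure ` \<N>)" if "\<And>i. b i \<in> B i" for b
  proof -
    have "sum b UNIV \<in> \<Union>\<N>"
      using that sum by blast
    then show ?thesis
      using closure_subset by blast
  qed
  then have "\<exists>F\<in>closure ` \<N>. \<exists>U. (\<forall>i\<in>UNIV. open (U i) \<and> K i \<inter> U i \<noteq> {}) \<and>
      (\<forall>u. (\<forall>i\<in>UNIV. u i \<in> K i \<inter> U i) \<longrightarrow> sum u UNIV \<in> F)"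
    using \<N>(1) assms(3,4) by (intro sum_nonmeager_closed_cover[of UNIV K B]) auto
  then obtain N U where "N \<in> \<N>" and U: "\<And>i. open (U i)" "\<And>i. K i \<inter> U i \<noteq> {}"
    and sub: "\<And>u. (\<And>i. u i \<in> K i \<inter> U i) \<Longrightarrow> sum u UNIV \<in> closure N"
    by auto
  have "\<exists>V. openin (top_of_set (K i)) V \<and> connected V \<and> bounded V \<and> V \<noteq> {} \<and> V \<subseteq> K i \<inter> U i" for i
  proof -
    obtain p where p: "p \<in> K i" "p \<in> U i"
      using U(2) by blast
    \<comment> \<open>The unit ball provides boundedness; local connectedness then gives a connected
      relatively open neighbourhood of \<open>p\<close> inside.\<close>
    have "openin (top_of_set (K i)) (K i \<inter> (U i \<inter> ball p 1))"
      using U(1) by (intro openin_open_Int open_Int open_ball)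
    moreover have "p \<in> K i \<inter> (U i \<inter> ball p 1)"
      using p by simp
    ultimately obtain V where "openin (top_of_set (K i)) V" "connected V" "p \<in> V"
      "V \<subseteq> K i \<inter> (U i \<inter> ball p 1)"
      using assms(2)[of i] unfolding locally_connected by blast
    then show ?thesis
      using bounded_subset[OF bounded_ball, of V p 1] by blast
  qed
  then obtain V where V: "\<And>i. openin (top_of_set (K i)) (V i)" "\<And>i. connected (V i)"
      "\<And>i. bounded (V i)" "\<And>i. V i \<noteq> {}" "\<And>i. V i \<subseteq> K i \<inter> U i"
    by metis
  then obtain a b where ab: "\<And>i. a i \<in> V i" "\<And>i. b i \<in> V i" "basis_family (\<lambda>i. b i - a i)"
    using assms(1) unfolding collectively_nowhere_flat_def by metis
  have "interior (closure {\<Sum>i\<in>UNIV. u i | u. \<forall>i. u i \<in> V i}) \<noteq> {}"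
    using V(2,3) ab
    by (intro interior_closure_sum_connected_nonempty[of V a b]) (auto simp: basis_family_def)
  moreover have "{\<Sum>i\<in>UNIV. u i | u. \<forall>i. u i \<in> V i} \<subseteq> closure N"
    using V(5) sub by blast
  then have "closure {\<Sum>i\<in>UNIV. u i | u. \<forall>i. u i \<in> V i} \<subseteq> closure N"
    by (simp add: closure_minimal)
  ultimately show False
    using \<N>(2)[OF \<open>N \<in> \<N>\<close>] interior_mono by blast
qed

end
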